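(* Let $q\ge 5$ be an integer. In the hyperbolic Pascal triangle linked to $\{4,q\}$, for $n\ge 1$ let $a_n$ and $b_n$ be the number of vertices of type $A$ and of type $B$ in row $n$, respectively, and let $s_n=a_n+b_n+2$ (the total number of vertices of row $n$). Then each of the three sequences $\{a_n\}$, $\{b_n\}$, $\{s_n\}$ satisfies the ternary homogeneous recurrence relation $$x_n=(q-1)x_{n-1}-(q-1)x_{n-2}+x_{n-3}\qquad(n\ge 4),$$ with initial values $$a_1=0,\;a_2=1,\;a_3=2,\qquad b_1=0,\;b_2=0,\;b_3=q-4,\qquad s_1=2,\;s_2=3,\;s_3=q.$$ Moreover, with $$D=q^2-4q,\qquad \alpha_q=\frac{(q-2)+\sqrt{D}}{2},\qquad \beta_q=\frac{(q-2)-\sqrt{D}}{2},$$ the following explicit formulae hold for all $n\ge 1$: $$a_n=\left(\frac{2-q}{2}+\frac{q^2-4q+2}{2q(q-4)}\sqrt{D}\right)\alpha_q^n+\left(\frac{2-q}{2}-\frac{q^2-4q+2}{2q(q-4)}\sqrt{D}\right)\beta_q^n+1,$$ $$b_n=\left(\frac{q-3}{2}+\frac{1-q}{2q}\sqrt{D}\right)\alpha_q^n+\left(\frac{q-3}{2}-\frac{1-q}{2q}\sqrt{D}\right)\beta_q^n-1,$$ $$s_n=\left(-\frac12+\frac{q-2}{2q(q-4)}\sqrt{D}\right)\alpha_q^n+\left(-\frac12-\frac{q-2}{2q(q-4)}\sqrt{D}\right)\beta_q^n+2.$$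
   Context: The hyperbolic Pascal triangle linked to $\{4,q\}$ ($q\ge5$) is built on an infinite graph ${\mathcal I}_{4,q}$ (cut out of the regular hyperbolic mosaic with Schläfli symbol $\{4,q\}$), whose vertices are arranged in rows $0,1,2,\dots$, each row ordered from left to right, and whose edges join only vertices of consecutive rows. It is constructed as follows. Row $0$ consists of a single vertex $V_0$. Row $1$ consists of two vertices, both joined to $V_0$. For every $j\ge1$ the leftmost and rightmost vertices of row $j$ are called wingers; every other vertex has type $A$ or type $B$. Given row $j\ge 1$, row $j+1$ is obtained by drawing from each vertex of row $j$, in left-to-right order, downward edges: $2$ from a winger, $q-2$ from a vertex of type $A$, $q-1$ from a vertex of type $B$. For any two neighbouring vertices of row $j$, the last downward edge of the left one and the first downward edge of the right one end in one common vertex of row $j+1$, which has type $A$. Each of the remaining downward edges ends in its own separate vertex of row $j+1$; among these, the end of the first edge of the leftmost vertex and the end of the last edge of the rightmost vertex are the wingers of row $j+1$, and all the others have type $B$. The left-to-right order of row $j+1$ is the order of the edges. Wingers are not counted as type $A$ or type $B$ here. *)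

theory Defs
  imports Complex_Main
begin

datatype vkind = Apex | Winger | TypeA | TypeB

fun down_degree :: "nat \<Rightarrow> vkind \<Rightarrow> nat" where
  "down_degree q Apex = 2"
| "down_degree q Winger = 2"
| "down_degree q TypeA = q - 2"
| "down_degree q TypeB = q - 1"

text \<open>A row is the left-to-right list of the kinds of its vertices. The pair \<open>(i, k)\<close> is the
  \<open>k\<close>-th downward edge of the \<open>i\<close>-th vertex (both counted from 0 and from the left); the edges are
  listed from left to right.\<close>

definition down_edges :: "nat \<Rightarrow> vkind list \<Rightarrow> (nat \<times> nat) list" where
  "down_edges q r =
     concat (map (\<lambda>i. map (\<lambda>k. (i, k)) [0..<down_degree q (r ! i)]) [0..<length r])"

text \<open>A vertex of the next row is named by the leftmost edge that ends in it. The first edge of a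
  vertex that has a left neighbour ends where the last edge of this neighbour ends; every other
  edge is the leftmost one at its own end.\<close>

fun edge_end :: "nat \<Rightarrow> vkind list \<Rightarrow> nat \<times> nat \<Rightarrow> nat \<times> nat" where
  "edge_end q r (i, k) =
     (if k = 0 \<and> 0 < i then (i - 1, down_degree q (r ! (i - 1)) - 1) else (i, k))"

definition next_ends :: "nat \<Rightarrow> vkind list \<Rightarrow> (nat \<times> nat) list" where
  "next_ends q r = remdups (map (edge_end q r) (down_edges q r))"

text \<open>The kind of the vertex named \<open>(i, k)\<close>, for \<open>(i, k)\<close> in \<open>next_ends q r\<close>.\<close>

fun end_kind :: "nat \<Rightarrow> vkind list \<Rightarrow> nat \<times> nat \<Rightarrow> vkind" where
  "end_kind q r (i, k) =
     (if Suc k = down_degree q (r ! i) \<and> Suc i < length r then TypeA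
      else if (i = 0 \<and> k = 0) \<or> (Suc i = length r \<and> Suc k = down_degree q (r ! i)) then Winger
      else TypeB)"

primrec hpt_row :: "nat \<Rightarrow> nat \<Rightarrow> vkind list" where
  "hpt_row q 0 = [Apex]"
| "hpt_row q (Suc n) = map (end_kind q (hpt_row q n)) (next_ends q (hpt_row q n))"

text \<open>The graph itself: \<open>(n, i)\<close> is the \<open>i\<close>-th vertex of row \<open>n\<close>.\<close>

definition hpt_verts :: "nat \<Rightarrow> (nat \<times> nat) set" where
  "hpt_verts q = {(n, i). i < length (hpt_row q n)}"

definition hpt_edges :: "nat \<Rightarrow> (nat \<times> nat) set set" where
  "hpt_edges q =
     {{(n, i), (Suc n, p)} | n i k p.
        (i, k) \<in> set (down_edges q (hpt_row q n)) \<and>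
        p < length (next_ends q (hpt_row q n)) \<and>
        next_ends q (hpt_row q n) ! p = edge_end q (hpt_row q n) (i, k)}"

fun hpt_kind :: "nat \<Rightarrow> nat \<times> nat \<Rightarrow> vkind" where
  "hpt_kind q (n, i) = hpt_row q n ! i"

definition hpt_a :: "nat \<Rightarrow> nat \<Rightarrow> nat" where
  "hpt_a q n = card {v \<in> hpt_verts q. fst v = n \<and> hpt_kind q v = TypeA}"

definition hpt_b :: "nat \<Rightarrow> nat \<Rightarrow> nat" where
  "hpt_b q n = card {v \<in> hpt_verts q. fst v = n \<and> hpt_kind q v = TypeB}"

definition hpt_s :: "nat \<Rightarrow> nat \<Rightarrow> nat" where
  "hpt_s q n = hpt_a q n + hpt_b q n + 2"

definition hpt_recurrence :: "nat \<Rightarrow> (nat \<Rightarrow> nat) \<Rightarrow> bool" where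
  "hpt_recurrence q x \<longleftrightarrow>
     (\<forall>n\<ge>4. int (x n) =
        (int q - 1) * int (x (n - 1)) - (int q - 1) * int (x (n - 2)) + int (x (n - 3)))"

text \<open>The first two rows below the apex come out as the construction prescribes.\<close>

lemma hpt_row_1: "hpt_row q 1 = [Winger, Winger]"
  by (simp add: next_ends_def down_edges_def upt_rec)

lemma hpt_row_2: "hpt_row q 2 = [Winger, TypeA, Winger]"
  by (simp add: next_ends_def down_edges_def upt_rec numeral_2_eq_2)

end

theory Submission
  imports Defs
begin

text \<open>A vertex of the next row is an edge \<open>(i, k)\<close> that is the leftmost at its lower end, so the next
  row can be counted edge by edge, without describing the order of the vertices in it. As every
  down-degree is at least 2, these edges are all the edges except the first edges of the vertices
  that have a left neighbour. Hence below a row \<open>r\<close>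

  \<^item> the vertices of type \<open>A\<close> are the last edges of the vertices that have a right neighbour, so
    there are \<open>length r - 1\<close> of them;
  \<^item> the vertices of type \<open>B\<close> are the edges that are neither first nor last at their upper end, so
    each vertex \<open>v\<close> of \<open>r\<close> accounts for \<open>down_degree q v - 2\<close> of them;
  \<^item> there are exactly two wingers, and the apex does not reappear.

  For rows from row 1 on, this gives the linear system (\<open>hpt_a_Suc\<close>, \<open>hpt_b_Suc\<close>)
  \[ a' = a + b + 1, \qquad b' = (q-4)\,a + (q-3)\,b, \]
  whose matrix has trace \<open>q - 2\<close> and determinant 1. Its eigenvalues are therefore the two roots of
  \<open>x\<^sup>2 - (q - 2) x + 1\<close>, which are \<open>\<alpha>\<close> and \<open>\<beta>\<close>, and the constant term of the system adds the
  eigenvalue 1: the factor \<open>(x - 1) (x\<^sup>2 - (q - 2) x + 1)\<close> is the characteristic polynomial of the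
  ternary recurrence. Both sides of each explicit formula, less its constant, obey the binary
  recurrence, so that comparing rows 1 and 2 suffices (\<open>closed_form_of_binary_recurrence\<close>).\<close>

section \<open>Counting kinds in a row\<close>

lemma UNIV_vkind: "UNIV = {Apex, Winger, TypeA, TypeB}"
  using vkind.exhaust by auto

lemma sum_list_map_vkind:
  fixes f :: "vkind \<Rightarrow> nat"
  shows "sum_list (map f r) =
    count_list r Apex * f Apex + count_list r Winger * f Winger
    + count_list r TypeA * f TypeA + count_list r TypeB * f TypeB"
proof -
  have "sum_list (map f r) = (\<Sum>t\<in>{Apex, Winger, TypeA, TypeB}. count_list r t * f t)"
  proof (rule sum_list_map_eq_sum_count2)
    show "set r \<subseteq> {Apex, Winger, TypeA, TypeB}"
      by (simp flip: UNIV_vkind)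
  qed simp
  then show ?thesis
    by simp
qed

lemma count_list_map_distinct:
  assumes "distinct xs"
  shows "count_list (map f xs) t = card {x \<in> set xs. f x = t}"
proof -
  have "count_list (map f xs) t = length (filter (\<lambda>x. f x = t) xs)"
    by (induction xs) auto
  also have "\<dots> = card {x \<in> set xs. f x = t}"
    using assms by (simp flip: distinct_card)
  finally show ?thesis .
qed

lemma card_hpt_row: "card {v \<in> hpt_verts q. fst v = n} = length (hpt_row q n)"
proof -
  have "{v \<in> hpt_verts q. fst v = n} = Pair n ` {..<length (hpt_row q n)}"
    by (auto simp: hpt_verts_def)
  then show ?thesis
    by (simp add: card_image inj_on_def)
qed

lemma card_kind_eq_count_list:
  "card {v \<in> hpt_verts q. fst v = n \<and> hpt_kind q v = t} = count_list (hpt_row q n) t"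
proof -
  have "{v \<in> hpt_verts q. fst v = n \<and> hpt_kind q v = t} =
      Pair n ` {i. i < length (hpt_row q n) \<and> hpt_row q n ! i = t}"
    by (auto simp: hpt_verts_def)
  then show ?thesis
    by (simp add: card_image inj_on_def count_list_eq_length_filter length_filter_conv_card
        eq_commute[of t])
qed

section \<open>The vertices below a given row\<close>

lemma down_degree_ge_2: "q \<ge> 5 \<Longrightarrow> 2 \<le> down_degree q v"
  by (cases v) auto

lemma set_down_edges:
  "set (down_edges q r) = {(i, k). i < length r \<and> k < down_degree q (r ! i)}"
  by (auto simp: down_edges_def)

text \<open>A shared vertex is named by the last edge of its left parent, which is not also the first edge
  of that parent because its down-degree is at least 2. So every surviving name has \<open>k > 0\<close>, apart
  from the first edge of the leftmost vertex.\<close>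

lemma set_next_ends:
  assumes "q \<ge> 5"
  shows "set (next_ends q r) =
    {(i, k). i < length r \<and> k < down_degree q (r ! i) \<and> (i = 0 \<or> 0 < k)}" (is "_ = ?E")
proof
  have "edge_end q r e \<in> ?E" if "e \<in> set (down_edges q r)" for e
  proof (cases e)
    case (Pair i k)
    then show ?thesis
      using that down_degree_ge_2[OF assms, of "r ! (i - 1)"] by (auto simp: set_down_edges)
  qed
  then show "set (next_ends q r) \<subseteq> ?E"
    unfolding next_ends_def set_remdups set_map by (rule image_subsetI)
next
  have "(i, k) = edge_end q r (i, k)" if "(i, k) \<in> ?E" for i k
    using that by auto
  then show "?E \<subseteq> set (next_ends q r)"
    by (force simp: next_ends_def set_down_edges simp del: edge_end.simps)
qed

lemma count_list_next_row:
  "count_list (map (end_kind q r) (next_ends q r)) t =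
    card {e \<in> set (next_ends q r). end_kind q r e = t}"
  by (rule count_list_map_distinct) (simp add: next_ends_def)

lemma count_TypeA_next_row:
  assumes "q \<ge> 5"
  shows "count_list (map (end_kind q r) (next_ends q r)) TypeA = length r - 1"
proof -
  have "{e \<in> set (next_ends q r). end_kind q r e = TypeA} =
      (\<lambda>i. (i, down_degree q (r ! i) - 1)) ` {..<length r - 1}" (is "?L = ?R")
  proof
    show "?L \<subseteq> ?R"
    proof
      fix e
      assume e: "e \<in> ?L"
      obtain i k where "e = (i, k)"
        by (cases e)
      then have "e = (i, down_degree q (r ! i) - 1)" "i < length r - 1"
        using e by (auto split: if_splits)
      then show "e \<in> ?R"
        by simp
    qed
  next
    have "(i, down_degree q (r ! i) - 1) \<in> ?L" if "i < length r - 1" for i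
      using that down_degree_ge_2[OF assms, of "r ! i"] by (auto simp: set_next_ends[OF assms])
    then show "?R \<subseteq> ?L"
      by blast
  qed
  then show ?thesis
    by (simp add: count_list_next_row card_image inj_on_def)
qed

lemma count_TypeB_next_row:
  assumes "q \<ge> 5"
  shows "count_list (map (end_kind q r) (next_ends q r)) TypeB =
    sum_list (map (\<lambda>v. down_degree q v - 2) r)"
proof -
  have kind: "end_kind q r (i, k) = TypeB \<longleftrightarrow> 0 < k \<and> Suc k < down_degree q (r ! i)"
    if "i < length r" "k < down_degree q (r ! i)" "i = 0 \<or> 0 < k" for i k
  proof (cases "Suc i < length r")
    case False
    then have "Suc i = length r"
      using that(1) by simp
    then show ?thesis
      using that(2,3) by auto
  qed (use that in auto)
  have "{e \<in> set (next_ends q r). end_kind q r e = TypeB} =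
      (SIGMA i:{..<length r}. {1..<down_degree q (r ! i) - 1})"
    using kind by (auto simp: set_next_ends[OF assms] less_diff_conv simp del: end_kind.simps)
  then have "count_list (map (end_kind q r) (next_ends q r)) TypeB =
      (\<Sum>i<length r. down_degree q (r ! i) - 2)"
    by (simp add: count_list_next_row numeral_2_eq_2)
  then show ?thesis
    by (simp add: sum_list_sum_nth atLeast0LessThan)
qed

lemma count_Winger_next_row:
  assumes "q \<ge> 5" "r \<noteq> []"
  shows "count_list (map (end_kind q r) (next_ends q r)) Winger = 2"
proof -
  define l where "l = length r - 1"
  have l: "length r = Suc l"
    using assms(2) by (simp add: l_def)
  have deg: "2 \<le> down_degree q (r ! i)" for i
    by (rule down_degree_ge_2[OF assms(1)])
  have "{e \<in> set (next_ends q r). end_kind q r e = Winger} =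
      {(0, 0), (l, down_degree q (r ! l) - 1)}" (is "?L = ?R")
  proof
    show "?L \<subseteq> ?R"
    proof
      fix e
      assume e: "e \<in> ?L"
      obtain i k where "e = (i, k)"
        by (cases e)
      then show "e \<in> ?R"
        using e by (auto simp: l split: if_splits)
    qed
  next
    have "(0, 0) \<in> ?L"
      using deg[of 0] by (simp add: set_next_ends[OF assms(1)] l)
    moreover have "(l, down_degree q (r ! l) - 1) \<in> ?L"
      using deg[of l] by (simp add: set_next_ends[OF assms(1)] l)
    ultimately show "?R \<subseteq> ?L"
      by blast
  qed
  then show ?thesis
    using deg[of l] by (simp add: count_list_next_row)
qed

lemma count_Apex_next_row: "count_list (map (end_kind q r) (next_ends q r)) Apex = 0"
proof -
  have "Apex \<noteq> end_kind q r e" for e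
    by (cases e) simp
  then show ?thesis
    by (auto simp: count_list_0_iff simp del: end_kind.simps)
qed

section \<open>The linear system for the numbers of vertices\<close>

lemma hpt_row_not_Nil: "q \<ge> 5 \<Longrightarrow> hpt_row q n \<noteq> []"
proof (induction n)
  case (Suc n)
  then show ?case
    using count_Winger_next_row[of q "hpt_row q n"] by auto
qed simp

lemma count_list_hpt_row:
  assumes "q \<ge> 5" "n \<ge> 1"
  shows "count_list (hpt_row q n) Winger = 2" "count_list (hpt_row q n) Apex = 0"
  using assms by (cases n; simp add: count_Winger_next_row count_Apex_next_row hpt_row_not_Nil)+

lemma length_hpt_row:
  assumes "q \<ge> 5" "n \<ge> 1"
  shows "length (hpt_row q n) = hpt_s q n"
  using sum_list_map_vkind[of "\<lambda>_. 1" "hpt_row q n"] count_list_hpt_row[OF assms]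
  by (simp add: sum_list_triv hpt_s_def hpt_a_def hpt_b_def card_kind_eq_count_list)

lemma hpt_a_Suc:
  assumes "q \<ge> 5" "n \<ge> 1"
  shows "hpt_a q (Suc n) = hpt_a q n + hpt_b q n + 1"
proof -
  have "hpt_a q (Suc n) = length (hpt_row q n) - 1"
    by (simp add: hpt_a_def card_kind_eq_count_list count_TypeA_next_row[OF assms(1)])
  then show ?thesis
    by (simp add: length_hpt_row[OF assms] hpt_s_def)
qed

lemma hpt_b_Suc:
  assumes "q \<ge> 5" "n \<ge> 1"
  shows "hpt_b q (Suc n) = (q - 4) * hpt_a q n + (q - 3) * hpt_b q n"
proof -
  have "hpt_b q (Suc n) = sum_list (map (\<lambda>v. down_degree q v - 2) (hpt_row q n))"
    by (simp add: hpt_b_def card_kind_eq_count_list count_TypeB_next_row[OF assms(1)])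
  also have "\<dots> = (q - 4) * hpt_a q n + (q - 3) * hpt_b q n"
    by (simp add: sum_list_map_vkind count_list_hpt_row[OF assms] hpt_a_def hpt_b_def
        card_kind_eq_count_list eval_nat_numeral)
  finally show ?thesis .
qed

lemma hpt_row_1_counts: "hpt_a q 1 = 0" "hpt_b q 1 = 0"
  by (simp_all only: hpt_a_def hpt_b_def card_kind_eq_count_list hpt_row_1) simp_all

text \<open>Eliminating one of the two sequences from the system subtracts terms, so it is carried out over
  the integers.\<close>

lemma int_hpt_Suc:
  assumes "q \<ge> 5" "n \<ge> 1"
  shows "int (hpt_a q (Suc n)) = int (hpt_a q n) + int (hpt_b q n) + 1"
    and "int (hpt_b q (Suc n)) =
      (int q - 4) * int (hpt_a q n) + (int q - 3) * int (hpt_b q n)"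
  using assms(1) by (simp_all add: hpt_a_Suc[OF assms] hpt_b_Suc[OF assms] of_nat_diff)

text \<open>The constants 1, -1 and 2 are the values at the fixed point \<open>(a, b) = (1, -1)\<close> of the system.
  Subtracting them removes the constant term, and then the Cayley-Hamilton theorem for the matrix
  gives one recurrence of order 2 for all three sequences.\<close>

lemma hpt_binary_recurrence:
  assumes "q \<ge> 5" "n \<ge> 1"
  shows "int (hpt_a q (n + 2)) - 1 =
      (int q - 2) * (int (hpt_a q (n + 1)) - 1) - (int (hpt_a q n) - 1)"
    and "int (hpt_b q (n + 2)) + 1 =
      (int q - 2) * (int (hpt_b q (n + 1)) + 1) - (int (hpt_b q n) + 1)"
    and "int (hpt_s q (n + 2)) - 2 =
      (int q - 2) * (int (hpt_s q (n + 1)) - 2) - (int (hpt_s q n) - 2)"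
  using int_hpt_Suc[OF assms] int_hpt_Suc[OF assms(1), of "Suc n"]
  by (simp_all add: hpt_s_def algebra_simps)

text \<open>Taking the difference of two consecutive instances of the binary recurrence eliminates the
  constant; this is the factor \<open>x - 1\<close> of the characteristic polynomial.\<close>

lemma hpt_recurrence_of_binary:
  fixes c :: int
  assumes rec: "\<And>n. n \<ge> 1 \<Longrightarrow>
    int (x (n + 2)) - c = (int q - 2) * (int (x (n + 1)) - c) - (int (x n) - c)"
  shows "hpt_recurrence q x"
  unfolding hpt_recurrence_def
proof (intro allI impI)
  fix n :: nat
  assume "n \<ge> 4"
  then obtain m where m: "n = m + 3" "m \<ge> 1"
    using that[of "n - 3"] by simp
  show "int (x n) =
      (int q - 1) * int (x (n - 1)) - (int q - 1) * int (x (n - 2)) + int (x (n - 3))"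
    using rec[of m] rec[of "m + 1"] m by (simp add: algebra_simps numeral_eq_Suc)
qed

section \<open>The explicit formulae\<close>

text \<open>Both \<open>\<alpha>\<close> and \<open>\<beta>\<close> are roots of \<open>t\<^sup>2 - p t + 1\<close>, so the right-hand side obeys the same
  recurrence as \<open>h\<close>. Its value at index 0 is \<open>u + w\<close>, and the third assumption says that this value
  continues \<open>h\<close> backwards from \<open>h 1\<close> and \<open>h 2\<close>.\<close>

lemma closed_form_of_binary_recurrence:
  fixes h :: "nat \<Rightarrow> real"
  assumes rec: "\<And>n. n \<ge> 1 \<Longrightarrow> h (n + 2) = p * h (n + 1) - h n"
    and h1: "h 1 = u * \<alpha> + w * \<beta>"
    and h2: "h 2 = p * h 1 - (u + w)"
    and roots: "\<alpha>\<^sup>2 = p * \<alpha> - 1" "\<beta>\<^sup>2 = p * \<beta> - 1"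
    and "n \<ge> 1"
  shows "h n = u * \<alpha> ^ n + w * \<beta> ^ n"
proof -
  have step: "u * \<alpha> ^ (m + 2) + w * \<beta> ^ (m + 2) =
      p * (u * \<alpha> ^ (m + 1) + w * \<beta> ^ (m + 1)) - (u * \<alpha> ^ m + w * \<beta> ^ m)" for m
    by (simp only: power_add roots) (simp add: algebra_simps)
  have "h (m + 1) = u * \<alpha> ^ (m + 1) + w * \<beta> ^ (m + 1) \<and>
      h (m + 2) = u * \<alpha> ^ (m + 2) + w * \<beta> ^ (m + 2)" for m
  proof (induction m)
    case 0
    have "h 2 = u * \<alpha> ^ 2 + w * \<beta> ^ 2"
      using step[of 0] h1 h2 by (simp add: power2_eq_square)
    then show ?case
      using h1 by (simp add: numeral_2_eq_2)
  next
    case (Suc m)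
    then show ?case
      using rec[of "m + 1"] step[of "m + 1"] by simp
  qed
  from this[of "n - 1"] show ?thesis
    using \<open>n \<ge> 1\<close> by simp
qed

lemma real_binary_recurrence:
  fixes c :: int
  assumes "int x2 - c = (int q - 2) * (int x1 - c) - (int x0 - c)"
  shows "real x2 - of_int c = (real q - 2) * (real x1 - of_int c) - (real x0 - of_int c)"
  using arg_cong[OF assms, of real_of_int] by simp

theorem theorem1:
  fixes q :: nat and D \<alpha> \<beta> :: real
  assumes "q \<ge> 5"
    and "D = real q ^ 2 - 4 * real q"
    and "\<alpha> = ((real q - 2) + sqrt D) / 2"
    and "\<beta> = ((real q - 2) - sqrt D) / 2"
  shows "(\<forall>n\<ge>1. hpt_s q n = card {v \<in> hpt_verts q. fst v = n})
    \<and> hpt_recurrence q (hpt_a q) \<and> hpt_recurrence q (hpt_b q) \<and> hpt_recurrence q (hpt_s q)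
    \<and> hpt_a q 1 = 0 \<and> hpt_a q 2 = 1 \<and> hpt_a q 3 = 2
    \<and> hpt_b q 1 = 0 \<and> hpt_b q 2 = 0 \<and> int (hpt_b q 3) = int q - 4
    \<and> hpt_s q 1 = 2 \<and> hpt_s q 2 = 3 \<and> hpt_s q 3 = q
    \<and> (\<forall>n\<ge>1.
        real (hpt_a q n) =
          ((2 - real q) / 2 + (real q ^ 2 - 4 * real q + 2) / (2 * real q * (real q - 4)) * sqrt D) * \<alpha> ^ n
          + ((2 - real q) / 2 - (real q ^ 2 - 4 * real q + 2) / (2 * real q * (real q - 4)) * sqrt D) * \<beta> ^ n
          + 1
      \<and> real (hpt_b q n) =
          ((real q - 3) / 2 + (1 - real q) / (2 * real q) * sqrt D) * \<alpha> ^ n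
          + ((real q - 3) / 2 - (1 - real q) / (2 * real q) * sqrt D) * \<beta> ^ n
          - 1
      \<and> real (hpt_s q n) =
          (- 1 / 2 + (real q - 2) / (2 * real q * (real q - 4)) * sqrt D) * \<alpha> ^ n
          + (- 1 / 2 - (real q - 2) / (2 * real q * (real q - 4)) * sqrt D) * \<beta> ^ n
          + 2)"
proof -
  have q5: "real q \<ge> 5"
    using assms(1) by simp
  then have "D > 0"
    unfolding assms(2) by (simp add: power2_eq_square)
  then have sqrt_sq: "sqrt D * sqrt D = D"
    by simp
  have nz: "real q \<noteq> 0" "real q - 4 \<noteq> 0"
    using q5 by auto
  have D: "D = real q * (real q - 4)"
    by (simp add: assms(2) power2_eq_square algebra_simps)
  have roots: "\<alpha>\<^sup>2 = (real q - 2) * \<alpha> - 1" "\<beta>\<^sup>2 = (real q - 2) * \<beta> - 1"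
    using sqrt_sq unfolding assms(2-4) by (simp_all add: power2_eq_square field_simps)
  have row2: "hpt_a q 2 = 1" "hpt_b q 2 = 0"
    using hpt_a_Suc[OF assms(1), of 1] hpt_b_Suc[OF assms(1), of 1] hpt_row_1_counts[of q]
    by (simp_all add: numeral_2_eq_2)
  have row3: "hpt_a q 3 = 2" "hpt_b q 3 = q - 4"
    using hpt_a_Suc[OF assms(1), of 2] hpt_b_Suc[OF assms(1), of 2] row2
    by (simp_all add: numeral_3_eq_3 numeral_2_eq_2)
  note rec = hpt_binary_recurrence[OF assms(1)]
  \<comment> \<open>A pair of conjugate coefficients gives a value at index 1 that is free of square roots.\<close>
  have conj: "(u + v * sqrt D) * \<alpha> + (u - v * sqrt D) * \<beta> = u * (real q - 2) + v * D" for u v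
  proof -
    have "(u + v * sqrt D) * \<alpha> + (u - v * sqrt D) * \<beta> =
        u * (real q - 2) + v * (sqrt D * sqrt D)"
      unfolding assms(3,4) by (simp add: field_simps)
    then show ?thesis
      by (simp only: sqrt_sq)
  qed
  have closed: "h n = (u + v * sqrt D) * \<alpha> ^ n + (u - v * sqrt D) * \<beta> ^ n"
    if "\<And>n. n \<ge> 1 \<Longrightarrow> h (n + 2) = (real q - 2) * h (n + 1) - h n"
      and "h 1 = u * (real q - 2) + v * D" "h 2 = (real q - 2) * h 1 - 2 * u" "n \<ge> 1"
    for h :: "nat \<Rightarrow> real" and u v n
  proof (rule closed_form_of_binary_recurrence[OF that(1) _ _ roots that(4)])
    show "h 1 = (u + v * sqrt D) * \<alpha> + (u - v * sqrt D) * \<beta>"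
      by (simp only: conj that(2))
    show "h 2 = (real q - 2) * h 1 - ((u + v * sqrt D) + (u - v * sqrt D))"
      using that(3) by simp
  qed
  have vD: "(real q ^ 2 - 4 * real q + 2) / (2 * real q * (real q - 4)) * D = (D + 2) / 2"
      "(1 - real q) / (2 * real q) * D = (1 - real q) * (real q - 4) / 2"
      "(real q - 2) / (2 * real q * (real q - 4)) * D = (real q - 2) / 2"
    using nz by (simp_all add: D field_simps power2_eq_square)
  have a: "real (hpt_a q n) - 1 =
      ((2 - real q) / 2 + (real q ^ 2 - 4 * real q + 2) / (2 * real q * (real q - 4)) * sqrt D) * \<alpha> ^ n
      + ((2 - real q) / 2 - (real q ^ 2 - 4 * real q + 2) / (2 * real q * (real q - 4)) * sqrt D) * \<beta> ^ n"
    if "n \<ge> 1" for n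
  proof (rule closed[where h = "\<lambda>n. real (hpt_a q n) - 1", OF _ _ _ that])
    show "real (hpt_a q (n + 2)) - 1 =
        (real q - 2) * (real (hpt_a q (n + 1)) - 1) - (real (hpt_a q n) - 1)" if "n \<ge> 1" for n
      using real_binary_recurrence[OF rec(1)[OF that]] by simp
  qed (simp_all only: vD hpt_row_1_counts row2,
       simp_all add: D field_simps)
  have b: "real (hpt_b q n) + 1 =
      ((real q - 3) / 2 + (1 - real q) / (2 * real q) * sqrt D) * \<alpha> ^ n
      + ((real q - 3) / 2 - (1 - real q) / (2 * real q) * sqrt D) * \<beta> ^ n"
    if "n \<ge> 1" for n
  proof (rule closed[where h = "\<lambda>n. real (hpt_b q n) + 1", OF _ _ _ that])
    show "real (hpt_b q (n + 2)) + 1 =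
        (real q - 2) * (real (hpt_b q (n + 1)) + 1) - (real (hpt_b q n) + 1)" if "n \<ge> 1" for n
      using real_binary_recurrence[of _ "-1"] rec(2)[OF that] by simp
  qed (simp_all only: vD hpt_row_1_counts row2,
       simp_all add: field_simps)
  have s: "real (hpt_s q n) - 2 =
      (- 1 / 2 + (real q - 2) / (2 * real q * (real q - 4)) * sqrt D) * \<alpha> ^ n
      + (- 1 / 2 - (real q - 2) / (2 * real q * (real q - 4)) * sqrt D) * \<beta> ^ n"
    if "n \<ge> 1" for n
  proof (rule closed[where h = "\<lambda>n. real (hpt_s q n) - 2", OF _ _ _ that])
    show "real (hpt_s q (n + 2)) - 2 =
        (real q - 2) * (real (hpt_s q (n + 1)) - 2) - (real (hpt_s q n) - 2)" if "n \<ge> 1" for n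
      using real_binary_recurrence[OF rec(3)[OF that]] by simp
  qed (simp_all only: vD hpt_s_def hpt_row_1_counts row2,
       simp_all add: field_simps)
  have "hpt_recurrence q (hpt_a q)" "hpt_recurrence q (hpt_b q)" "hpt_recurrence q (hpt_s q)"
    using rec(2) by (auto intro!: hpt_recurrence_of_binary[of "hpt_a q" 1]
        hpt_recurrence_of_binary[of "hpt_b q" "-1"] hpt_recurrence_of_binary[of "hpt_s q" 2]
        simp only: rec(1,3) diff_minus_eq_add)
  moreover have "hpt_s q n = card {v \<in> hpt_verts q. fst v = n}" if "n \<ge> 1" for n
    by (simp only: card_hpt_row length_hpt_row[OF assms(1) that])
  moreover have "hpt_s q 1 = 2" "hpt_s q 2 = 3" "hpt_s q 3 = q" "int (hpt_b q 3) = int q - 4"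
    using assms(1) by (simp_all only: hpt_s_def hpt_row_1_counts row2 row3)
  moreover note hpt_row_1_counts row2 row3(1)
  moreover note a[unfolded diff_eq_eq] b[folded eq_diff_eq] s[unfolded diff_eq_eq]
  ultimately show ?thesis
    by blast
qed

end
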